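(* Suppose that (A1) $d(0)>0$; (A2) the target is stationary, i.e. $\dot{\bm x}(t)\equiv \bm 0_2$ for all $t\ge 0$; and (A3) there is a constant $\eta>0$ with $d^*-\|\tilde{\bm x}(0)\|\ge \eta>0$. Then, along the closed-loop system consisting of the agent $\dot{\bm y}=\bm u$, the target estimator and the circumnavigation controller (all defined in the context), the norm of the target estimation error $\|\tilde{\bm x}(t)\|$ converges to zero within the predefined time $T_{c,1}$, i.e. $\|\tilde{\bm x}(t)\|=0$ for all $t\ge T_{c,1}$.
   Context: Target and agent: the target has constant position $\bm x\in\mathbb R^2$; the agent has position $\bm y(t)\in\mathbb R^2$ with $\dot{\bm y}(t)=\bm u(t)$. Let $d(t)=\|\bm x-\bm y(t)\|$ (Euclidean norm), $\bm\varphi(t)=(\bm x-\bm y(t))/d(t)$ (the bearing vector), and $\bar{\bm\varphi}(t)$ the unit vector obtained by rotating $\bm\varphi(t)$ clockwise by $\pi/2$. The estimate of the target position is $\hat{\bm x}(t)\in\mathbb R^2$, the estimation error is $\tilde{\bm x}(t)=\hat{\bm x}(t)-\bm x$, and $\hat d(t)=\|\hat{\bm x}(t)-\bm y(t)\|$, $\tilde d(t)=\hat d(t)-d^*$. Constants: $d^*>0$ (desired radius), $\omega^*>0$ (desired angular velocity), $k_\omega=\omega^*d^*$, $\alpha_1,\alpha_2\in(0,1]$, $T_{c,2}>T_{c,1}>0$. Functions: for $\beta\ge0$, $\bm z\in\mathbb R^n$: $\bm\psi^\beta(\bm z)=\|\bm z\|^{-\beta}\bm z$ if $\bm z\ne\bm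 0_n$ and $\bm\psi^\beta(\bm 0_n)=\bm 0_n$. For scalar $z$ and $\beta\ge 0$: $\mathrm{sig}^\beta(z)=\mathrm{sign}(z)|z|^\beta$, with $\mathrm{sig}^0=\mathrm{sign}$. Target estimator: $\dot{\hat{\bm x}}(t)=-\frac{1}{\alpha_1T_{c,1}}\exp(\|\bm\xi(t)\|^{\alpha_1})\,\bm\psi^{\alpha_1}(\bm\xi(t))$, where $\bm\xi(0)=\bm 0_2$ and $\bm\xi(t)=P^{-1}(t)\big(P(t)\hat{\bm x}(t)-\bm q(t)\big)$ for $t>0$, with $P(t)\in\mathbb R^{2\times2}$, $\bm q(t)\in\mathbb R^2$ given by $\dot P=-P+\bar{\bm\varphi}\bar{\bm\varphi}^\top$, $P(0)=\bm 0_{2\times 2}$, and $\dot{\bm q}=-\bm q+\bar{\bm\varphi}\bar{\bm\varphi}^\top\bm y$, $\bm q(0)=\bm 0_2$. Circumnavigation controller: $\bm u(t)=\frac{\exp(|\tilde d(t)|^{\alpha_2})}{\alpha_2T_{c,2}}\mathrm{sig}^{1-\alpha_2}(\tilde d(t))\,\bm\varphi(t)+k_\omega\bar{\bm\varphi}(t)$. Solutions are understood in the sense of Filippov where the right-hand side is discontinuous. *)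

theory Defs
  imports "HOL-Analysis.Analysis"
begin

text \<open>
  A finite set of pairs (u, v) represents a finite family of non-overlapping closed
  intervals; degenerate intervals are harmless.
\<close>

definition abs_continuous_on_interval ::
    "real \<Rightarrow> real \<Rightarrow> (real \<Rightarrow> 'a::real_normed_vector) \<Rightarrow> bool" where
  "abs_continuous_on_interval a b f \<longleftrightarrow>
     (\<forall>\<epsilon>>0. \<exists>\<delta>>0. \<forall>D :: (real \<times> real) set.
        finite D \<longrightarrow>
        (\<forall>(u, v)\<in>D. a \<le> u \<and> u \<le> v \<and> v \<le> b) \<longrightarrow>
        pairwise (\<lambda>(u, v) (u', v'). disjnt {u<..<v} {u'<..<v'}) D \<longrightarrow>
        (\<Sum>(u, v)\<in>D. v - u) < \<delta> \<longrightarrow>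
        (\<Sum>(u, v)\<in>D. norm (f v - f u)) < \<epsilon>)"

text \<open>
  The Filippov set-valued map regularises in the state only, at each fixed time. Since
  Lebesgue-null sets of states are discarded, the values that a totalised right-hand side
  takes on a null set (such as those produced by division by zero or by the inverse of a
  singular matrix) have no influence on it.
\<close>

definition filippov_map ::
    "(real \<Rightarrow> 'a \<Rightarrow> 'a) \<Rightarrow> real \<Rightarrow> 'a::euclidean_space \<Rightarrow> 'a set" where
  "filippov_map f t z =
     (\<Inter>\<delta>\<in>{0<..}. \<Inter>N\<in>{N. negligible N}. closure (convex hull (f t ` (ball z \<delta> - N))))"

definition filippov_solution ::
    "(real \<Rightarrow> 'a \<Rightarrow> 'a) \<Rightarrow> (real \<Rightarrow> 'a::euclidean_space) \<Rightarrow> bool" where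
  "filippov_solution f z \<longleftrightarrow>
     (\<forall>T>0. abs_continuous_on_interval 0 T z) \<and>
     (AE t in lebesgue. 0 < t \<longrightarrow>
        (\<exists>v\<in>filippov_map f t (z t). (z has_vector_derivative v) (at t)))"

definition psi :: "real \<Rightarrow> 'a::real_normed_vector \<Rightarrow> 'a" where
  "psi \<beta> z = (if z = 0 then 0 else norm z powr (- \<beta>) *\<^sub>R z)"

definition sig :: "real \<Rightarrow> real \<Rightarrow> real" where
  "sig \<beta> z = sgn z * \<bar>z\<bar> powr \<beta>"

definition bearing :: "real^2 \<Rightarrow> real^2 \<Rightarrow> real^2" where
  "bearing x y = (x - y) /\<^sub>R norm (x - y)"

definition rotate_clockwise :: "real^2 \<Rightarrow> real^2" where
  "rotate_clockwise v = vector [v $ 2, - (v $ 1)]"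

definition bearing_perp :: "real^2 \<Rightarrow> real^2 \<Rightarrow> real^2" where
  "bearing_perp x y = rotate_clockwise (bearing x y)"

definition outer_square :: "real^'n \<Rightarrow> real^'n^'n" where
  "outer_square v = (columnvector v :: real^1^'n) ** (rowvector v :: real^'n^1)"

definition xi :: "real \<Rightarrow> real^2 \<Rightarrow> real^2^2 \<Rightarrow> real^2 \<Rightarrow> real^2" where
  "xi t xhat P q = (if t = 0 then 0 else matrix_inv P *v (P *v xhat - q))"

definition estimator_rhs ::
    "real \<Rightarrow> real \<Rightarrow> real \<Rightarrow> real^2 \<Rightarrow> real^2^2 \<Rightarrow> real^2 \<Rightarrow> real^2" where
  "estimator_rhs \<alpha>1 Tc1 t xhat P q =
     (let \<xi> = xi t xhat P q
      in - ((1 / (\<alpha>1 * Tc1) * exp (norm \<xi> powr \<alpha>1)) *\<^sub>R psi \<alpha>1 \<xi>))"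

definition P_rhs :: "real^2 \<Rightarrow> real^2 \<Rightarrow> real^2^2 \<Rightarrow> real^2^2" where
  "P_rhs x y P = - P + outer_square (bearing_perp x y)"

definition q_rhs :: "real^2 \<Rightarrow> real^2 \<Rightarrow> real^2 \<Rightarrow> real^2" where
  "q_rhs x y q = - q + outer_square (bearing_perp x y) *v y"

definition controller ::
    "real \<Rightarrow> real \<Rightarrow> real \<Rightarrow> real \<Rightarrow> real^2 \<Rightarrow> real^2 \<Rightarrow> real^2 \<Rightarrow> real^2" where
  "controller dstar \<omega>star \<alpha>2 Tc2 x y xhat =
     (let dtilde = norm (xhat - y) - dstar; k\<omega> = \<omega>star * dstar
      in (exp (\<bar>dtilde\<bar> powr \<alpha>2) / (\<alpha>2 * Tc2) * sig (1 - \<alpha>2) dtilde) *\<^sub>R bearing x y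
         + k\<omega> *\<^sub>R bearing_perp x y)"

text \<open>
  The state is (y, xhat, P, q); the target position x enters as a time signal.
\<close>

definition closed_loop ::
    "real \<Rightarrow> real \<Rightarrow> real \<Rightarrow> real \<Rightarrow> real \<Rightarrow> real \<Rightarrow> (real \<Rightarrow> real^2) \<Rightarrow>
     real \<Rightarrow> (real^2) \<times> (real^2) \<times> (real^2^2) \<times> (real^2) \<Rightarrow>
     (real^2) \<times> (real^2) \<times> (real^2^2) \<times> (real^2)" where
  "closed_loop dstar \<omega>star \<alpha>1 \<alpha>2 Tc1 Tc2 x t = (\<lambda>(y, xhat, P, q).
     (controller dstar \<omega>star \<alpha>2 Tc2 (x t) y xhat,
      estimator_rhs \<alpha>1 Tc1 t xhat P q,
      P_rhs (x t) y P,
      q_rhs (x t) y q))"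

end

theory Submission
  imports Defs
begin

text \<open>
  Write \<open>c\<close> for the constant target position. The residual \<open>P c - q\<close> decays: since the matrix
  \<open>outer_square (bearing_perp c y)\<close> annihilates \<open>c - y\<close>, its derivative is \<open>-(P c - q)\<close>, whatever
  the agent does. It starts at zero, so \<open>q = P c\<close> for all times (\<open>q_eq\<close>). Hence, wherever \<open>P\<close> is
  invertible, the regression error \<open>\<xi>\<close> equals the estimation error \<open>xhat - c\<close>, and the estimator
  is an autonomous differential equation for that error.

  \<open>P t\<close> is invertible for every \<open>t > 0\<close> (\<open>P_pos_def\<close>, \<open>det_P\<close>). For a fixed vector \<open>e\<close> the quantity
  \<open>exp t * (e \<bullet> P t e)\<close> never decreases, as the forcing of \<open>P\<close> is positive semidefinite. If it were
  still zero at some positive time, \<open>e\<close> would be orthogonal to the rotated bearing throughout an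
  initial interval, that is, the agent would stay on the line through the target with direction
  \<open>e\<close>. But initially it is away from the target, and there the controller has the tangential
  speed \<open>\<omega>star * dstar > 0\<close>, which forces it off that line. Because of the monotonicity, what
  happens on an arbitrarily short initial interval settles invertibility for ever, even if the
  agent were to meet the target later.

  For \<open>V = norm (xhat - c)\<close> the estimator gives
  \<open>V' = - exp (V powr \<alpha>1) * V powr (1 - \<alpha>1) / (\<alpha>1 * Tc1)\<close> while \<open>V > 0\<close>, so \<open>exp (- (V powr \<alpha>1))\<close>
  has slope \<open>1 / Tc1\<close>. It is positive at time zero and at most one, hence \<open>V\<close> must vanish
  by time \<open>Tc1\<close>, and it stays zero as it is nonincreasing (\<open>predefined_time_convergence\<close>).

  Two tools make this rigorous for Filippov solutions. An absolutely continuous real function with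
  nonnegative derivative almost everywhere is nondecreasing
  (\<open>abs_continuous_mono_if_AE_deriv_nonneg\<close>). And every linear functional of a Filippov velocity
  inherits a lower bound that holds for the vector field at all neighbouring states
  (\<open>filippov_map_linear_ge\<close>); all that is used about the regularised dynamics are such bounds.
\<close>

section \<open>Absolutely continuous functions\<close>

text \<open>
  The closure properties of absolute continuity below (linear and bilinear images, composition with
  continuously differentiable functions, linear combinations) are all instances of this one.
\<close>

lemma abs_continuous_dominated:
  fixes f :: "real \<Rightarrow> 'a::real_normed_vector" and g :: "real \<Rightarrow> 'b::real_normed_vector"
    and h :: "real \<Rightarrow> 'c::real_normed_vector"
  assumes f: "abs_continuous_on_interval a b f" and g: "abs_continuous_on_interval a b g"
    and dom: "\<And>u v. a \<le> u \<Longrightarrow> u \<le> v \<Longrightarrow> v \<le> b \<Longrightarrow>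
      norm (h v - h u) \<le> C * (norm (f v - f u) + norm (g v - g u))"
  shows "abs_continuous_on_interval a b h"
  unfolding abs_continuous_on_interval_def
proof (intro allI impI)
  fix e :: real assume "e > 0"
  define c where "c = \<bar>C\<bar> + 1"
  have "c > 0" unfolding c_def by simp
  then have "e / (2 * c) > 0" using \<open>e > 0\<close> by simp
  obtain d1 where "d1 > 0" and d1: "\<And>D :: (real \<times> real) set. finite D \<Longrightarrow>
      (\<forall>(u, v)\<in>D. a \<le> u \<and> u \<le> v \<and> v \<le> b) \<Longrightarrow>
      pairwise (\<lambda>(u, v) (u', v'). disjnt {u<..<v} {u'<..<v'}) D \<Longrightarrow>
      (\<Sum>(u, v)\<in>D. v - u) < d1 \<Longrightarrow> (\<Sum>(u, v)\<in>D. norm (f v - f u)) < e / (2 * c)"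
    using f \<open>e / (2 * c) > 0\<close> unfolding abs_continuous_on_interval_def by meson
  obtain d2 where "d2 > 0" and d2: "\<And>D :: (real \<times> real) set. finite D \<Longrightarrow>
      (\<forall>(u, v)\<in>D. a \<le> u \<and> u \<le> v \<and> v \<le> b) \<Longrightarrow>
      pairwise (\<lambda>(u, v) (u', v'). disjnt {u<..<v} {u'<..<v'}) D \<Longrightarrow>
      (\<Sum>(u, v)\<in>D. v - u) < d2 \<Longrightarrow> (\<Sum>(u, v)\<in>D. norm (g v - g u)) < e / (2 * c)"
    using g \<open>e / (2 * c) > 0\<close> unfolding abs_continuous_on_interval_def by meson
  show "\<exists>\<delta>>0. \<forall>D. finite D \<longrightarrow> (\<forall>(u, v)\<in>D. a \<le> u \<and> u \<le> v \<and> v \<le> b) \<longrightarrow>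
      pairwise (\<lambda>(u, v) (u', v'). disjnt {u<..<v} {u'<..<v'}) D \<longrightarrow>
      (\<Sum>(u, v)\<in>D. v - u) < \<delta> \<longrightarrow> (\<Sum>(u, v)\<in>D. norm (h v - h u)) < e"
  proof (intro exI[of _ "min d1 d2"] conjI allI impI)
    show "min d1 d2 > 0" using \<open>d1 > 0\<close> \<open>d2 > 0\<close> by simp
  next
    fix D :: "(real \<times> real) set"
    assume D: "finite D" "\<forall>(u, v)\<in>D. a \<le> u \<and> u \<le> v \<and> v \<le> b"
      "pairwise (\<lambda>(u, v) (u', v'). disjnt {u<..<v} {u'<..<v'}) D"
      "(\<Sum>(u, v)\<in>D. v - u) < min d1 d2"
    have "(\<Sum>(u, v)\<in>D. norm (h v - h u))
        \<le> (\<Sum>(u, v)\<in>D. c * norm (f v - f u) + c * norm (g v - g u))"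
    proof (rule sum_mono, clarify)
      fix u v assume "(u, v) \<in> D"
      then have "norm (h v - h u) \<le> C * (norm (f v - f u) + norm (g v - g u))"
        using D(2) dom by blast
      also have "\<dots> \<le> c * (norm (f v - f u) + norm (g v - g u))"
        unfolding c_def by (intro mult_right_mono) auto
      finally show "norm (h v - h u) \<le> c * norm (f v - f u) + c * norm (g v - g u)"
        by (simp add: distrib_left)
    qed
    also have "\<dots> = c * (\<Sum>(u, v)\<in>D. norm (f v - f u)) + c * (\<Sum>(u, v)\<in>D. norm (g v - g u))"
      by (simp add: sum.distrib sum_distrib_left case_prod_unfold)
    also have "\<dots> < c * (e / (2 * c)) + c * (e / (2 * c))"
      using d1[OF D(1-3)] d2[OF D(1-3)] D(4) \<open>c > 0\<close>
      by (intro add_strict_mono mult_strict_left_mono) auto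
    also have "\<dots> = e" using \<open>c > 0\<close> by (simp add: field_simps)
    finally show "(\<Sum>(u, v)\<in>D. norm (h v - h u)) < e" .
  qed
qed

lemma abs_continuous_subset:
  assumes "abs_continuous_on_interval a b f" and sub: "a \<le> a'" "b' \<le> b"
  shows "abs_continuous_on_interval a' b' f"
  unfolding abs_continuous_on_interval_def
proof (intro allI impI)
  fix e :: real assume "e > 0"
  then obtain \<delta> where "\<delta> > 0" and \<delta>: "\<And>D :: (real \<times> real) set. finite D \<Longrightarrow>
      (\<forall>(u, v)\<in>D. a \<le> u \<and> u \<le> v \<and> v \<le> b) \<Longrightarrow>
      pairwise (\<lambda>(u, v) (u', v'). disjnt {u<..<v} {u'<..<v'}) D \<Longrightarrow>
      (\<Sum>(u, v)\<in>D. v - u) < \<delta> \<Longrightarrow> (\<Sum>(u, v)\<in>D. norm (f v - f u)) < e"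
    using assms(1) unfolding abs_continuous_on_interval_def by meson
  show "\<exists>\<delta>>0. \<forall>D. finite D \<longrightarrow> (\<forall>(u, v)\<in>D. a' \<le> u \<and> u \<le> v \<and> v \<le> b') \<longrightarrow>
      pairwise (\<lambda>(u, v) (u', v'). disjnt {u<..<v} {u'<..<v'}) D \<longrightarrow>
      (\<Sum>(u, v)\<in>D. v - u) < \<delta> \<longrightarrow> (\<Sum>(u, v)\<in>D. norm (f v - f u)) < e"
  proof (intro exI[of _ \<delta>] conjI allI impI \<open>\<delta> > 0\<close>, rule \<delta>)
    fix D :: "(real \<times> real) set"
    assume "\<forall>(u, v)\<in>D. a' \<le> u \<and> u \<le> v \<and> v \<le> b'"
    then show "\<forall>(u, v)\<in>D. a \<le> u \<and> u \<le> v \<and> v \<le> b" using sub by fastforce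
  qed
qed

lemma abs_continuous_ident: "abs_continuous_on_interval a b (\<lambda>t :: real. t)"
  unfolding abs_continuous_on_interval_def
proof (intro allI impI)
  fix e :: real assume "e > 0"
  show "\<exists>\<delta>>0. \<forall>D. finite D \<longrightarrow> (\<forall>(u, v)\<in>D. a \<le> u \<and> u \<le> v \<and> v \<le> b) \<longrightarrow>
      pairwise (\<lambda>(u, v) (u', v'). disjnt {u<..<v} {u'<..<v'}) D \<longrightarrow>
      (\<Sum>(u, v)\<in>D. v - u) < \<delta> \<longrightarrow> (\<Sum>(u, v)\<in>D. norm (v - u)) < e"
  proof (intro exI[of _ e] conjI allI impI \<open>e > 0\<close>)
    fix D :: "(real \<times> real) set"
    assume D: "\<forall>(u, v)\<in>D. a \<le> u \<and> u \<le> v \<and> v \<le> b" "(\<Sum>(u, v)\<in>D. v - u) < e"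
    have "(\<Sum>(u, v)\<in>D. norm (v - u)) = (\<Sum>(u, v)\<in>D. v - u)"
      using D(1) by (intro sum.cong) auto
    then show "(\<Sum>(u, v)\<in>D. norm (v - u)) < e" using D(2) by simp
  qed
qed

lemma abs_continuous_imp_continuous_on:
  fixes f :: "real \<Rightarrow> 'a::real_normed_vector"
  assumes "abs_continuous_on_interval a b f"
  shows "continuous_on {a..b} f"
  unfolding continuous_on_iff
proof (intro ballI allI impI)
  fix t e :: real assume t: "t \<in> {a..b}" and "e > 0"
  obtain \<delta> where "\<delta> > 0" and \<delta>: "\<And>D :: (real \<times> real) set. finite D \<Longrightarrow>
      (\<forall>(u, v)\<in>D. a \<le> u \<and> u \<le> v \<and> v \<le> b) \<Longrightarrow>
      pairwise (\<lambda>(u, v) (u', v'). disjnt {u<..<v} {u'<..<v'}) D \<Longrightarrow>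
      (\<Sum>(u, v)\<in>D. v - u) < \<delta> \<Longrightarrow> (\<Sum>(u, v)\<in>D. norm (f v - f u)) < e"
    using assms \<open>e > 0\<close> unfolding abs_continuous_on_interval_def by meson
  have "dist (f s) (f t) < e" if "s \<in> {a..b}" "dist s t < \<delta>" for s
  proof (cases "s \<le> t")
    case True
    then show ?thesis
      using \<delta>[of "{(s, t)}"] that t by (auto simp: dist_norm norm_minus_commute)
  next
    case False
    then show ?thesis
      using \<delta>[of "{(t, s)}"] that t by (auto simp: dist_norm)
  qed
  then show "\<exists>d>0. \<forall>s\<in>{a..b}. dist s t < d \<longrightarrow> dist (f s) (f t) < e"
    using \<open>\<delta> > 0\<close> by blast
qed

lemma abs_continuous_bounded_linear:
  assumes "bounded_linear L" "abs_continuous_on_interval a b f"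
  shows "abs_continuous_on_interval a b (\<lambda>t. L (f t))"
proof -
  interpret bounded_linear L by fact
  obtain K where K: "\<And>w. norm (L w) \<le> norm w * K" using bounded by blast
  show ?thesis
  proof (rule abs_continuous_dominated[OF assms(2) assms(2), of _ "\<bar>K\<bar>"])
    fix u v
    have "norm (L (f v) - L (f u)) \<le> norm (f v - f u) * K"
      using K by (simp flip: diff)
    also have "\<dots> \<le> norm (f v - f u) * \<bar>K\<bar>" by (intro mult_left_mono) auto
    also have "\<dots> \<le> \<bar>K\<bar> * (norm (f v - f u) + norm (f v - f u))"
      by (simp add: algebra_simps)
    finally show "norm (L (f v) - L (f u)) \<le> \<bar>K\<bar> * (norm (f v - f u) + norm (f v - f u))" .
  qed
qed

lemma abs_continuous_bounded_bilinear:
  assumes "bounded_bilinear B" and f: "abs_continuous_on_interval a b f"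
    and g: "abs_continuous_on_interval a b g"
  shows "abs_continuous_on_interval a b (\<lambda>t. B (f t) (g t))"
proof -
  interpret bounded_bilinear B by fact
  obtain K where "K > 0" and K: "\<And>w z. norm (B w z) \<le> norm w * norm z * K"
    using pos_bounded by blast
  have "bounded (f ` {a..b})" "bounded (g ` {a..b})"
    using f g abs_continuous_imp_continuous_on compact_continuous_image compact_imp_bounded
      compact_Icc by blast+
  then obtain M1 M2 where M: "\<And>t. t \<in> {a..b} \<Longrightarrow> norm (f t) \<le> M1" "\<And>t. t \<in> {a..b} \<Longrightarrow> norm (g t) \<le> M2"
    unfolding bounded_iff by blast
  define M where "M = max M1 M2"
  show ?thesis
  proof (rule abs_continuous_dominated[OF f g, of _ "M * K"])
    fix u v assume uv: "a \<le> u" "u \<le> v" "v \<le> b"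
    have "B (f v) (g v) - B (f u) (g u) = B (f v - f u) (g v) + B (f u) (g v - g u)"
      by (simp add: diff_left diff_right)
    then have "norm (B (f v) (g v) - B (f u) (g u))
        \<le> norm (f v - f u) * norm (g v) * K + norm (f u) * norm (g v - g u) * K"
      using K norm_triangle_mono by metis
    also have "\<dots> \<le> norm (f v - f u) * M * K + M * norm (g v - g u) * K"
    proof -
      have "norm (f u) \<le> M" "norm (g v) \<le> M"
        using M(1)[of u] M(2)[of v] uv unfolding M_def by auto
      moreover from this(1) have "0 \<le> M" using norm_ge_zero order_trans by blast
      ultimately show ?thesis
        using \<open>K > 0\<close> by (intro add_mono mult_mono mult_nonneg_nonneg) auto
    qed
    finally show "norm (B (f v) (g v) - B (f u) (g u)) \<le> M * K * (norm (f v - f u) + norm (g v - g u))"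
      by (simp add: algebra_simps)
  qed
qed

lemma abs_continuous_compose_C1:
  fixes f g g' :: "real \<Rightarrow> real"
  assumes f: "abs_continuous_on_interval a b f"
    and range: "\<And>t. t \<in> {a..b} \<Longrightarrow> f t \<in> {m..M}"
    and g: "\<And>s. s \<in> {m..M} \<Longrightarrow> (g has_real_derivative g' s) (at s)"
    and g': "continuous_on {m..M} g'"
  shows "abs_continuous_on_interval a b (\<lambda>t. g (f t))"
proof -
  have "bounded (g' ` {m..M})"
    using g' compact_continuous_image compact_imp_bounded compact_Icc by blast
  then obtain K where K: "\<And>s. s \<in> {m..M} \<Longrightarrow> norm (g' s) \<le> K"
    unfolding bounded_iff by blast
  show ?thesis
  proof (rule abs_continuous_dominated[OF f f, of _ "\<bar>K\<bar>"])
    fix u v assume uv: "a \<le> u" "u \<le> v" "v \<le> b"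
    have "norm (g (f v) - g (f u)) \<le> \<bar>K\<bar> * norm (f v - f u)"
    proof (rule field_differentiable_bound[of "{m..M}"])
      show "(g has_field_derivative g' s) (at s within {m..M})" if "s \<in> {m..M}" for s
        using g[OF that] has_field_derivative_at_within by blast
      show "norm (g' s) \<le> \<bar>K\<bar>" if "s \<in> {m..M}" for s using K[OF that] by linarith
    qed (use range uv in auto)
    then show "norm (g (f v) - g (f u)) \<le> \<bar>K\<bar> * (norm (f v - f u) + norm (f v - f u))"
      by (smt (verit) distrib_left mult_nonneg_nonneg abs_ge_zero norm_ge_zero)
  qed
qed

text \<open>
  A Henstock-style argument. On a sufficiently fine tagged division of the interval, pieces tagged by
  a point with nonnegative derivative contribute at least a small negative multiple of their length
  to \<open>f b - f a\<close>. The remaining tags lie in a null set, so the total length of their pieces is small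
  because the indicator of that set has integral zero; absolute continuity then bounds their
  contribution.
\<close>

lemma abs_continuous_mono_if_AE_deriv_nonneg:
  fixes f :: "real \<Rightarrow> real"
  assumes ac: "abs_continuous_on_interval a b f" and ab: "a \<le> b"
    and ae: "AE t in lebesgue. a < t \<and> t < b \<longrightarrow> (\<exists>d\<ge>0. (f has_vector_derivative d) (at t))"
  shows "f a \<le> f b"
proof -
  define N where "N = {t\<in>{a..b}. \<not> (a < t \<and> t < b \<and> (\<exists>d\<ge>0. (f has_vector_derivative d) (at t)))}"
  have "negligible N"
  proof -
    obtain M where M: "M \<in> null_sets lebesgue"
      "{t. \<not> (a < t \<and> t < b \<longrightarrow> (\<exists>d\<ge>0. (f has_vector_derivative d) (at t)))} \<subseteq> M"
      using ae unfolding eventually_ae_filter by auto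
    have "N \<subseteq> M \<union> {a, b}"
      using M(2) unfolding N_def by force
    moreover have "negligible (M \<union> {a, b})"
      using M(1) negligible_iff_null_sets by (intro negligible_Un) auto
    ultimately show ?thesis
      using negligible_subset by blast
  qed
  then have ind: "((indicator N :: real \<Rightarrow> real) has_integral 0) {a..b}"
    unfolding negligible_def by (metis box_real(2))
  have "f a - f b \<le> e * (b - a) + e" if "e > 0" for e
  proof -
    obtain \<delta> where "\<delta> > 0" and \<delta>: "\<And>D :: (real \<times> real) set. finite D \<Longrightarrow>
        (\<forall>(u, v)\<in>D. a \<le> u \<and> u \<le> v \<and> v \<le> b) \<Longrightarrow>
        pairwise (\<lambda>(u, v) (u', v'). disjnt {u<..<v} {u'<..<v'}) D \<Longrightarrow>
        (\<Sum>(u, v)\<in>D. v - u) < \<delta> \<Longrightarrow> (\<Sum>(u, v)\<in>D. norm (f v - f u)) < e"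
      using ac \<open>e > 0\<close> unfolding abs_continuous_on_interval_def by meson
    \<comment> \<open>on divisions fine for this gauge, the pieces with tags in \<open>N\<close> have total length below \<open>\<delta>\<close>\<close>
    obtain \<gamma>1 where "gauge \<gamma>1" and \<gamma>1: "\<And>p. p tagged_division_of {a..b} \<Longrightarrow> \<gamma>1 fine p \<Longrightarrow>
        norm ((\<Sum>(x, k)\<in>p. measure lborel k *\<^sub>R (indicator N x :: real)) - 0) < \<delta>"
      using ind \<open>\<delta> > 0\<close> unfolding has_integral_real by meson
    have straddle: "\<exists>s>0. \<forall>u v. t - s < u \<and> u \<le> t \<and> t \<le> v \<and> v < t + s \<longrightarrow>
        f u - f v \<le> e * (v - u)" if t: "t \<in> {a..b} - N" for t
    proof -
      obtain d where "d \<ge> 0" and "(f has_vector_derivative d) (at t)"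
        using t unfolding N_def by blast
      then have "\<exists>s>0. \<forall>z. norm (z - t) < s \<longrightarrow> norm (f z - f t - (z - t) *\<^sub>R d) \<le> e * norm (z - t)"
        using \<open>e > 0\<close> unfolding has_vector_derivative_def has_derivative_at_alt by blast
      then obtain s where "s > 0" and s: "\<And>z. \<bar>z - t\<bar> < s \<Longrightarrow> \<bar>f z - f t - (z - t) * d\<bar> \<le> e * \<bar>z - t\<bar>"
        by auto
      have "f u - f v \<le> e * (v - u)" if "t - s < u" "u \<le> t" "t \<le> v" "v < t + s" for u v
      proof -
        have "\<bar>f v - f t - (v - t) * d\<bar> \<le> e * (v - t)" "\<bar>f u - f t - (u - t) * d\<bar> \<le> e * (t - u)"
          using s[of v] s[of u] that by auto
        moreover have "(v - t) * d \<ge> 0" "(u - t) * d \<le> 0"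
          using that \<open>d \<ge> 0\<close> by (auto simp: mult_nonpos_nonneg)
        ultimately show ?thesis by (simp add: algebra_simps)
      qed
      then show ?thesis using \<open>s > 0\<close> by blast
    qed
    then obtain s where s0: "\<And>t. t \<in> {a..b} - N \<Longrightarrow> s t > 0"
      and s: "\<And>t u v. t \<in> {a..b} - N \<Longrightarrow> t - s t < u \<Longrightarrow> u \<le> t \<Longrightarrow> t \<le> v \<Longrightarrow> v < t + s t \<Longrightarrow>
        f u - f v \<le> e * (v - u)"
      by metis
    define \<gamma>2 where "\<gamma>2 t = (if t \<in> {a..b} - N then ball t (s t) else ball t 1)" for t
    have "gauge \<gamma>2"
      using s0 unfolding gauge_def \<gamma>2_def by auto
    then have "gauge (\<lambda>t. \<gamma>1 t \<inter> \<gamma>2 t)"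
      using \<open>gauge \<gamma>1\<close> by auto
    then obtain p where p: "p tagged_division_of {a..b}" and fine: "(\<lambda>t. \<gamma>1 t \<inter> \<gamma>2 t) fine p"
      using fine_division_exists_real by blast
    have "finite p" using p by auto
    have K: "\<exists>u v. K = {u..v} \<and> u \<le> t \<and> t \<le> v \<and> a \<le> u \<and> v \<le> b \<and> Inf K = u \<and> Sup K = v"
      if tK: "(t, K) \<in> p" for t K
    proof -
      obtain u v where "K = {u..v}" using tagged_division_ofD(4)[OF p tK] by auto
      moreover have "t \<in> K" "K \<subseteq> {a..b}" using tagged_division_ofD(2,3)[OF p tK] by auto
      ultimately show ?thesis by (intro exI[of _ u] exI[of _ v]) auto
    qed
    define L where "L = (\<lambda>(t :: real, K :: real set). Sup K - Inf K)"
    define F where "F = (\<lambda>(t :: real, K :: real set). f (Inf K) - f (Sup K))"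
    define B where "B = {x \<in> p. fst x \<in> N}"
    \<comment> \<open>degenerate pieces are left out so that different pieces have different end points\<close>
    define B' where "B' = {x \<in> B. L x > 0}"
    have L0: "L x \<ge> 0" if "x \<in> p" for x
      using K that unfolding L_def by (cases x) fastforce
    have good: "sum F (p - B) \<le> e * (b - a)"
    proof -
      have "sum F (p - B) \<le> (\<Sum>x\<in>p - B. e * L x)"
      proof (rule sum_mono)
        fix x assume x: "x \<in> p - B"
        obtain t K where tK: "x = (t, K)" by (cases x)
        obtain u v where uv: "K = {u..v}" "u \<le> t" "t \<le> v" "a \<le> u" "v \<le> b" "Inf K = u" "Sup K = v"
          using K x tK by blast
        have t: "t \<in> {a..b} - N" using x tK uv unfolding B_def by auto
        have "K \<subseteq> ball t (s t)"
          using fine x tK t unfolding fine_def \<gamma>2_def by fastforce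
        moreover have "u \<in> K" "v \<in> K" using uv(1-3) by auto
        ultimately have "u \<in> ball t (s t)" "v \<in> ball t (s t)" by blast+
        then show "F x \<le> e * L x"
          using s[OF t, of u v] uv tK unfolding F_def L_def by (auto simp: dist_real_def)
      qed
      also have "\<dots> \<le> (\<Sum>x\<in>p. e * L x)"
        using \<open>finite p\<close> L0 \<open>e > 0\<close> by (intro sum_mono2) auto
      also have "\<dots> = e * (b - a)"
        using additive_tagged_division_1[OF ab p, of "\<lambda>x. x"] unfolding L_def
        by (simp add: sum_distrib_left[symmetric] case_prod_unfold)
      finally show ?thesis .
    qed
    have bad: "sum F B \<le> e"
    proof -
      define h where "h = (\<lambda>(t :: real, K :: real set). (Inf K, Sup K))"
      have B'p: "B' \<subseteq> p" "B' \<subseteq> B" "finite B'" "B \<subseteq> p" "finite B"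
        using \<open>finite p\<close> unfolding B'_def B_def by auto
      have dj: "disjnt {Inf K<..<Sup K} {Inf K'<..<Sup K'}"
        if "(t, K) \<in> p" "(t', K') \<in> p" "(t, K) \<noteq> (t', K')" for t K t' K'
      proof -
        have "interior K \<inter> interior K' = {}"
          using tagged_division_ofD(5)[OF p that] .
        moreover have "interior K = {Inf K<..<Sup K}" "interior K' = {Inf K'<..<Sup K'}"
          using K[OF that(1)] K[OF that(2)] interior_atLeastAtMost_real by metis+
        ultimately show ?thesis
          unfolding disjnt_def by simp
      qed
      have inj: "inj_on h B'"
      proof (rule inj_onI, rule ccontr)
        fix x x' assume x: "x \<in> B'" "x' \<in> B'" "h x = h x'" "x \<noteq> x'"
        obtain t K t' K' where tK: "x = (t, K)" "x' = (t', K')" by (cases x, cases x')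
        have "disjnt {Inf K<..<Sup K} {Inf K'<..<Sup K'}"
          using dj x B'p tK by blast
        moreover have "Inf K = Inf K'" "Sup K = Sup K'" "Inf K < Sup K"
          using x tK unfolding h_def B'_def L_def by auto
        ultimately show False
          by (metis disjnt_self_iff_empty greaterThanLessThan_empty_iff not_le)
      qed
      have "sum L B' \<le> sum L B"
        using B'p L0 by (intro sum_mono2) auto
      also have "\<dots> = (\<Sum>(x, k)\<in>p. measure lborel k *\<^sub>R (indicator N x :: real))"
      proof -
        have "sum L B = (\<Sum>x\<in>p. if fst x \<in> N then L x else 0)"
          unfolding B_def using \<open>finite p\<close> by (simp add: sum.inter_filter)
        also have "\<dots> = (\<Sum>(x, k)\<in>p. measure lborel k *\<^sub>R (indicator N x :: real))"
        proof (rule sum.cong[OF refl], clarify)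
          fix t k assume "(t, k) \<in> p"
          from K[OF this] have "measure lborel k = Sup k - Inf k"
            by (metis content_real order_trans)
          then show "(if fst (t, k) \<in> N then L (t, k) else 0) = measure lborel k *\<^sub>R (indicator N t :: real)"
            unfolding L_def by auto
        qed
        finally show ?thesis .
      qed
      also have "\<dots> < \<delta>"
        using \<gamma>1[OF p] fine by (auto simp: fine_Int)
      finally have "sum L B' < \<delta>" .
      moreover have "(\<Sum>(u, v)\<in>h ` B'. v - u) = sum L B'"
        unfolding sum.reindex[OF inj] by (rule sum.cong) (auto simp: h_def L_def)
      moreover have "\<forall>(u, v)\<in>h ` B'. a \<le> u \<and> u \<le> v \<and> v \<le> b"
        using K B'p unfolding h_def by fastforce
      moreover have "pairwise (\<lambda>(u, v) (u', v'). disjnt {u<..<v} {u'<..<v'}) (h ` B')"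
        using B'p dj unfolding pairwise_def h_def by fastforce
      ultimately have "(\<Sum>(u, v)\<in>h ` B'. norm (f v - f u)) < e"
        using \<delta>[of "h ` B'"] B'p by auto
      moreover have "sum F B' \<le> (\<Sum>(u, v)\<in>h ` B'. norm (f v - f u))"
        unfolding sum.reindex[OF inj] by (rule sum_mono) (auto simp: h_def F_def)
      moreover have "sum F B' = sum F B"
      proof (rule sum.mono_neutral_left[OF B'p(5) B'p(2)], rule ballI)
        fix x assume x: "x \<in> B - B'"
        then have "x \<in> p" using B'p(4) by blast
        then have "L x \<ge> 0" by (rule L0)
        moreover have "\<not> L x > 0" using x unfolding B'_def by blast
        ultimately have "L x = 0" by linarith
        then show "F x = 0" unfolding F_def L_def by (cases x) auto
      qed
      ultimately show ?thesis by linarith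
    qed
    have "f a - f b = - (\<Sum>(x,K)\<in>p. f (Sup K) - f (Inf K))"
      using additive_tagged_division_1[OF ab p, of f] by simp
    also have "\<dots> = sum F p"
      unfolding F_def sum_negf[symmetric] by (rule sum.cong) auto
    also have "\<dots> = sum F (p - B) + sum F B"
      using \<open>finite p\<close> by (intro sum.subset_diff) (auto simp: B_def)
    finally show ?thesis using good bad by linarith
  qed
  then have "f a - f b \<le> 0 + e" if "e > 0" for e
  proof -
    have "e / (b - a + 1) > 0" using ab that by auto
    then have "f a - f b \<le> e / (b - a + 1) * (b - a) + e / (b - a + 1)"
      using \<open>\<And>e. e > 0 \<Longrightarrow> f a - f b \<le> e * (b - a) + e\<close> by blast
    also have "\<dots> = e / (b - a + 1) * (b - a + 1)" by (simp only: distrib_left mult_1_right)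
    also have "\<dots> = e" using ab by simp
    finally show ?thesis by simp
  qed
  then show ?thesis
    using field_le_epsilon[of "f a - f b" 0] by auto
qed

section \<open>Linear bounds on Filippov velocities\<close>

text \<open>
  Up to an error \<open>e\<close>, the field takes values in the closed half space \<open>{w. g z - e \<le> L w}\<close> on a small
  ball around \<open>z\<close>. This half space is closed and convex, so it contains the closed convex hull.
\<close>

lemma filippov_map_linear_ge:
  fixes L :: "'a::euclidean_space \<Rightarrow> real"
  assumes w: "w \<in> filippov_map f t z" and L: "bounded_linear L"
    and g: "isCont g z" and le: "\<forall>\<^sub>F z' in nhds z. g z' \<le> L (f t z')"
  shows "g z \<le> L w"
proof (rule field_le_epsilon)
  fix e :: real assume "e > 0"
  have "\<forall>\<^sub>F z' in nhds z. g z - e < g z'"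
    using g \<open>e > 0\<close> unfolding isCont_def tendsto_at_iff_tendsto_nhds
    by (intro order_tendstoD(1)[where y = "g z"]) auto
  with le have "\<forall>\<^sub>F z' in nhds z. g z - e \<le> L (f t z')"
    by eventually_elim auto
  then obtain \<delta> where "\<delta> > 0" and \<delta>: "\<And>z'. dist z' z < \<delta> \<Longrightarrow> g z - e \<le> L (f t z')"
    unfolding eventually_nhds_metric by blast
  define H where "H = L -` {g z - e..}"
  interpret bounded_linear L by fact
  have "closed H"
    unfolding H_def by (intro closed_vimage continuous_on_id continuous_on closed_atLeast) 
  moreover have "convex H"
    unfolding H_def using convex_linear_vimage[OF linear_axioms] by simp
  moreover have "f t ` (ball z \<delta> - {}) \<subseteq> H"
    using \<delta> unfolding H_def by (auto simp: dist_commute)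
  ultimately have "closure (convex hull (f t ` (ball z \<delta> - {}))) \<subseteq> H"
    by (intro closure_minimal hull_minimal)
  moreover have "w \<in> closure (convex hull (f t ` (ball z \<delta> - {})))"
    using w \<open>\<delta> > 0\<close> unfolding filippov_map_def by (auto dest!: bspec[where x = \<delta>] spec[where x = "{}"])
  ultimately have "w \<in> H" by blast
  then show "g z \<le> L w + e" unfolding H_def by simp
qed

lemma filippov_map_cong:
  assumes "f t = g t"
  shows "filippov_map f t z = filippov_map g t z"
  unfolding filippov_map_def assms ..

section \<open>Planar rotation, bearing and matrix inverse\<close>

lemma rotate_clockwise_nth [simp]:
  "rotate_clockwise v $ 1 = v $ 2" "rotate_clockwise v $ 2 = - (v $ 1)"
  by (simp_all add: rotate_clockwise_def)

lemma linear_rotate_clockwise: "linear rotate_clockwise"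
  by (rule linearI) (simp_all add: vec_eq_iff forall_2)

lemma rotate_clockwise_scaleR: "rotate_clockwise (r *\<^sub>R v) = r *\<^sub>R rotate_clockwise v"
  by (rule linear_scale[OF linear_rotate_clockwise])

lemma inner_rotate_clockwise_self [simp]: "v \<bullet> rotate_clockwise v = 0" "rotate_clockwise v \<bullet> v = 0"
  by (simp_all add: inner_vec_def sum_2)

lemma inner_rotate_clockwise [simp]: "rotate_clockwise v \<bullet> rotate_clockwise w = v \<bullet> w"
  by (simp add: inner_vec_def sum_2)

lemma outer_square_mult: "outer_square v *v w = (v \<bullet> w) *\<^sub>R v"
  by (simp add: outer_square_def vec_eq_iff matrix_vector_mult_def matrix_matrix_mult_def
      columnvector_def rowvector_def inner_vec_def sum_distrib_left mult.commute mult.left_commute)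

lemma bearing_perp_eq: "bearing_perp c y = rotate_clockwise (c - y) /\<^sub>R norm (c - y)"
  by (simp add: bearing_perp_def bearing_def rotate_clockwise_scaleR)

lemma outer_square_bearing_perp_mult:
  "outer_square (bearing_perp c y) *v c = outer_square (bearing_perp c y) *v y"
proof -
  have "bearing_perp c y \<bullet> (c - y) = 0" by (simp add: bearing_perp_eq)
  then show ?thesis by (simp add: outer_square_mult inner_diff_right)
qed

lemma isCont_bearing:
  assumes "isCont f z" "f z \<noteq> c"
  shows "isCont (\<lambda>z. bearing c (f z)) z"
  unfolding bearing_def using assms by (intro continuous_intros) auto

lemma isCont_bearing_perp:
  assumes "isCont f z" "f z \<noteq> c"
  shows "isCont (\<lambda>z. bearing_perp c (f z)) z"
proof -
  have "bounded_linear rotate_clockwise"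
    using linear_rotate_clockwise linear_conv_bounded_linear by blast
  from bounded_linear.isCont[OF this isCont_bearing[OF assms]] show ?thesis
    unfolding bearing_perp_def .
qed

lemma isCont_matrix_vector_mult:
  fixes f :: "'a::t2_space \<Rightarrow> real^'n^'m"
  assumes "isCont f z" "isCont g z"
  shows "isCont (\<lambda>z. f z *v g z) z"
  using assms unfolding isCont_def matrix_vector_mult_def
  by (intro vec_tendstoI) (simp, intro tendsto_sum tendsto_mult tendsto_vec_nth)

text \<open>
  The index \<open>3 - i\<close> is the one other than \<open>i\<close>.
\<close>

lemma matrix_inv_2:
  fixes A :: "real^2^2"
  assumes "det A \<noteq> 0"
  shows "matrix_inv A = (\<chi> i j. (if i = j then A $ (3 - i) $ (3 - i) else - A $ i $ j) / det A)"
proof -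
  define B :: "real^2^2" where
    "B = (\<chi> i j. (if i = j then A $ (3 - i) $ (3 - i) else - A $ i $ j) / det A)"
  have three: "(3::2) - 1 = 2" "(3::2) - 2 = 1" by auto
  have d: "A$1$1 * A$2$2 - A$1$2 * A$2$1 \<noteq> 0" using assms unfolding det_2 .
  have AB: "A ** B = mat 1" 
    unfolding B_def matrix_matrix_mult_def mat_def vec_eq_iff forall_2 sum_2 det_2
    using d by (simp add: three divide_simps) 
  have "invertible A" using assms invertible_det_nz by blast
  then have "matrix_inv A ** A = mat 1"
    unfolding invertible_def matrix_inv_def by (rule someI2_ex) blast
  then have "matrix_inv A = B"
    using AB by (metis matrix_mul_assoc matrix_mul_lid matrix_mul_rid)
  then show ?thesis unfolding B_def .
qed

lemma isCont_matrix_inv_2: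
  fixes A :: "real^2^2"
  assumes "det A \<noteq> 0"
  shows "isCont matrix_inv A"
proof -
  define B :: "real^2^2 \<Rightarrow> real^2^2" where
    "B A = (\<chi> i j. (if i = j then A $ (3 - i) $ (3 - i) else - A $ i $ j) / det A)" for A
  have det: "isCont (det :: real^2^2 \<Rightarrow> real) A"
    unfolding det_2[abs_def] by (intro continuous_intros)
  have "isCont B A"
    unfolding isCont_def B_def using det assms
    by (intro vec_tendstoI) (auto simp: isCont_def intro!: tendsto_intros)
  moreover have "\<forall>\<^sub>F A' in nhds A. det A' \<noteq> 0"
    using det assms unfolding isCont_def tendsto_at_iff_tendsto_nhds
    by (rule tendsto_imp_eventually_ne)
  then have "\<forall>\<^sub>F A' in nhds A. matrix_inv A' = B A'"
    by eventually_elim (simp add: matrix_inv_2 B_def)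
  ultimately show ?thesis
    by (simp add: isCont_cong)
qed

section \<open>Filippov velocities along the closed-loop field\<close>

context
  fixes dstar \<omega>star \<alpha>1 \<alpha>2 Tc1 Tc2 :: real and c :: "real^2"
begin

abbreviation "stationary_loop \<equiv> closed_loop dstar \<omega>star \<alpha>1 \<alpha>2 Tc1 Tc2 (\<lambda>_. c)"

text \<open>
  The map sending a velocity to \<open>e \<bullet> (vP *v c - vq)\<close> is linear, and on the unregularised field its
  value is exactly \<open>- (e \<bullet> (P *v c - q))\<close> at every state, including \<open>y = c\<close>, where the bearing is
  the zero vector.
\<close>

lemma velocity_residual:
  assumes v: "(vy, vx, vP, vq) \<in> filippov_map stationary_loop t (Y, X, A, r)"
  shows "e \<bullet> (vP *v c - vq) \<le> - (e \<bullet> (A *v c - r))"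
proof -
  define L where "L = (\<lambda>v :: (real^2) \<times> (real^2) \<times> (real^2^2) \<times> (real^2).
    - (e \<bullet> (fst (snd (snd v)) *v c - snd (snd (snd v)))))"
  define g where "g = (\<lambda>z. - L z)"
  have "linear L"
    unfolding L_def by (rule linearI)
      (simp_all add: matrix_vector_mult_add_rdistrib inner_diff_right inner_add_right
        flip: scaleR_matrix_vector_assoc, simp_all add: algebra_simps)
  then have L: "bounded_linear L" by (simp add: linear_conv_bounded_linear)
  have "isCont g (Y, X, A, r)"
    unfolding g_def using linear_continuous_at[OF L] by (intro continuous_intros) 
  moreover have "g z \<le> L (stationary_loop t z)" for z
  proof (cases z)
    case (fields y' x' P' q')
    have "(P_rhs c y' P') *v c - q_rhs c y' q' = - (P' *v c - q')"
      by (simp add: P_rhs_def q_rhs_def matrix_vector_mult_add_rdistrib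
          outer_square_bearing_perp_mult[of c y'] matrix_vector_mult_diff_rdistrib)
    then show ?thesis
      unfolding g_def L_def fields by (simp add: closed_loop_def inner_diff_right)
  qed
  ultimately have "g (Y, X, A, r) \<le> L (vy, vx, vP, vq)"
    by (intro filippov_map_linear_ge[OF v L]) auto
  then show ?thesis unfolding g_def L_def by simp
qed

lemma linear_quadratic_form:
  "linear (\<lambda>v :: (real^2) \<times> (real^2) \<times> (real^2^2) \<times> (real^2). e \<bullet> (fst (snd (snd v)) *v e))"
  by (rule linearI)
    (simp_all add: matrix_vector_mult_add_rdistrib inner_add_right
        flip: scaleR_matrix_vector_assoc)

lemma quadratic_form_P_rhs:
  "e \<bullet> (P_rhs c y' P' *v e) = (bearing_perp c y' \<bullet> e)\<^sup>2 - e \<bullet> (P' *v e)"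
  by (simp add: P_rhs_def matrix_vector_mult_diff_rdistrib outer_square_mult inner_diff_right
      power2_eq_square inner_commute)

text \<open>
  The bound comes from dropping the square in \<open>quadratic_form_P_rhs\<close>. It thus holds at every
  state, also at the target, where the bearing is discontinuous.
\<close>

lemma velocity_quadratic_form:
  assumes v: "(vy, vx, vP, vq) \<in> filippov_map stationary_loop t (Y, X, A, r)"
  shows "- (e \<bullet> (A *v e)) \<le> e \<bullet> (vP *v e)"
proof -
  define L where "L = (\<lambda>v :: (real^2) \<times> (real^2) \<times> (real^2^2) \<times> (real^2).
    e \<bullet> (fst (snd (snd v)) *v e))"
  have L: "bounded_linear L"
    unfolding L_def using linear_quadratic_form by (simp add: linear_conv_bounded_linear)
  have "isCont (\<lambda>z. - L z) (Y, X, A, r)"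
    using linear_continuous_at[OF L] by (intro continuous_intros)
  moreover have "- L z \<le> L (stationary_loop t z)" for z
    by (cases z) (simp add: L_def closed_loop_def quadratic_form_P_rhs)
  ultimately have "- L (Y, X, A, r) \<le> L (vy, vx, vP, vq)"
    by (intro filippov_map_linear_ge[OF v L]) auto
  then show ?thesis unfolding L_def by simp
qed

text \<open>
  Away from the target the bearing is continuous, so the square can be kept.
\<close>

lemma velocity_quadratic_form_regular:
  assumes v: "(vy, vx, vP, vq) \<in> filippov_map stationary_loop t (Y, X, A, r)" and "Y \<noteq> c"
  shows "(bearing_perp c Y \<bullet> e)\<^sup>2 - e \<bullet> (A *v e) \<le> e \<bullet> (vP *v e)"
proof -
  define L where "L = (\<lambda>v :: (real^2) \<times> (real^2) \<times> (real^2^2) \<times> (real^2).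
    e \<bullet> (fst (snd (snd v)) *v e))"
  define g where "g = (\<lambda>z. (bearing_perp c (fst z) \<bullet> e)\<^sup>2 - L z)"
  have L: "bounded_linear L"
    unfolding L_def using linear_quadratic_form by (simp add: linear_conv_bounded_linear)
  have "isCont g (Y, X, A, r)"
    unfolding g_def using linear_continuous_at[OF L] \<open>Y \<noteq> c\<close>
    by (intro continuous_intros isCont_bearing_perp) auto
  moreover have "g z \<le> L (stationary_loop t z)" for z
    by (cases z) (simp add: L_def g_def closed_loop_def quadratic_form_P_rhs)
  ultimately have "g (Y, X, A, r) \<le> L (vy, vx, vP, vq)"
    by (intro filippov_map_linear_ge[OF v L]) auto
  then show ?thesis unfolding L_def g_def by simp
qed

text \<open>
  The radial part of the controller may jump, but it is locally bounded and its direction at states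
  near \<open>Y\<close> is almost orthogonal to \<open>rotate_clockwise (c - Y)\<close>. In the limit only the tangential part
  remains.
\<close>

lemma velocity_tangential:
  assumes v: "(vy, vx, vP, vq) \<in> filippov_map stationary_loop t (Y, X, A, r)" and "Y \<noteq> c"
    and pos: "dstar > 0" "\<omega>star > 0" "0 < \<alpha>2" "\<alpha>2 \<le> 1" "0 < Tc2"
  shows "0 < vy \<bullet> rotate_clockwise (c - Y)"
proof -
  define b where "b = rotate_clockwise (c - Y)"
  define L where "L = (\<lambda>v :: (real^2) \<times> (real^2) \<times> (real^2^2) \<times> (real^2). fst v \<bullet> b)"
  \<comment> \<open>the absolute value of the range error as a function of the state, which controls the radial gain\<close>
  define s where "s = (\<lambda>z :: (real^2) \<times> (real^2) \<times> (real^2^2) \<times> (real^2).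
    \<bar>norm (fst (snd z) - fst z) - dstar\<bar>)"
  define K where "K = (\<lambda>z. exp (1 + s z) / (\<alpha>2 * Tc2) * (1 + s z))"
  define g where "g = (\<lambda>z. \<omega>star * dstar * (bearing_perp c (fst z) \<bullet> b) - K z * \<bar>bearing c (fst z) \<bullet> b\<bar>)"
  have L: "bounded_linear L"
    unfolding L_def by (intro bounded_linear_intros)
  have "isCont g (Y, X, A, r)"
    unfolding g_def K_def s_def using \<open>Y \<noteq> c\<close> pos
    by (intro continuous_intros isCont_bearing_perp isCont_bearing) auto
  moreover have "g z \<le> L (stationary_loop t z)" for z
  proof (cases z)
    case (fields y' x' P' q')
    define d where "d = norm (x' - y') - dstar"
    \<comment> \<open>crude, but continuous in the state; the gain itself jumps at \<open>d = 0\<close> when \<open>\<alpha>2 = 1\<close>\<close>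
    have powr_le: "\<bar>d\<bar> powr a \<le> 1 + \<bar>d\<bar>" if "0 \<le> a" "a \<le> 1" for a
    proof (cases "\<bar>d\<bar> \<le> 1")
      case True
      then show ?thesis using powr_le1[of a "\<bar>d\<bar>"] that by simp
    next
      case False
      then have "\<bar>d\<bar> powr a \<le> \<bar>d\<bar> powr 1" using that by (intro powr_mono) auto
      also have "\<dots> \<le> 1 + \<bar>d\<bar>" by simp
      finally show ?thesis .
    qed
    define m where "m = exp (\<bar>d\<bar> powr \<alpha>2) / (\<alpha>2 * Tc2) * sig (1 - \<alpha>2) d"
    have "\<bar>sig (1 - \<alpha>2) d\<bar> \<le> 1 + \<bar>d\<bar>"
    proof -
      have "\<bar>sig (1 - \<alpha>2) d\<bar> \<le> 1 * \<bar>d\<bar> powr (1 - \<alpha>2)"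
        unfolding sig_def abs_mult by (intro mult_mono) (simp_all add: sgn_if)
      then show ?thesis using powr_le[of "1 - \<alpha>2"] pos by linarith
    qed
    then have "\<bar>m\<bar> \<le> exp (1 + \<bar>d\<bar>) / (\<alpha>2 * Tc2) * (1 + \<bar>d\<bar>)"
      unfolding m_def abs_mult using pos powr_le[of \<alpha>2]
      by (intro mult_mono) (auto intro!: divide_right_mono)
    also have "\<dots> = K z" unfolding K_def s_def fields d_def by simp
    finally have "\<bar>m\<bar> * \<bar>bearing c y' \<bullet> b\<bar> \<le> K z * \<bar>bearing c y' \<bullet> b\<bar>"
      by (intro mult_right_mono) auto
    then have "- (m * (bearing c y' \<bullet> b)) \<le> K z * \<bar>bearing c y' \<bullet> b\<bar>"
      by (metis abs_ge_minus_self abs_mult order_trans)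
    moreover have "L (stationary_loop t z) = m * (bearing c y' \<bullet> b) + \<omega>star * dstar * (bearing_perp c y' \<bullet> b)"
      unfolding L_def fields m_def d_def
      by (simp add: closed_loop_def controller_def Let_def inner_add_left)
    ultimately show ?thesis unfolding g_def fields by simp
  qed
  ultimately have "g (Y, X, A, r) \<le> L (vy, vx, vP, vq)"
    by (intro filippov_map_linear_ge[OF v L]) auto
  moreover have "bearing c Y \<bullet> b = 0" "0 < bearing_perp c Y \<bullet> b"
    using \<open>Y \<noteq> c\<close> unfolding b_def by (simp_all add: bearing_def bearing_perp_eq)
  ultimately show ?thesis
    using pos unfolding L_def g_def b_def by (auto intro: less_le_trans[rotated])
qed

text \<open>
  For invertible \<open>A\<close> the regression error is a continuous function of the state, with value
  \<open>X - c\<close> here. Since \<open>psi \<alpha>1\<close> is continuous away from zero, the field can be evaluated directly.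
\<close>

lemma velocity_estimator:
  assumes v: "(vy, vx, vP, vq) \<in> filippov_map stationary_loop t (Y, X, A, r)" and "t > 0"
    and A: "det A \<noteq> 0" and r: "r = A *v c" and "X \<noteq> c" and pos: "0 < \<alpha>1" "0 < Tc1"
  shows "(X - c) \<bullet> vx \<le> - (exp (norm (X - c) powr \<alpha>1) * norm (X - c) powr (2 - \<alpha>1) / (\<alpha>1 * Tc1))"
proof -
  define L where "L = (\<lambda>v :: (real^2) \<times> (real^2) \<times> (real^2^2) \<times> (real^2). - ((X - c) \<bullet> fst (snd v)))"
  have L: "bounded_linear L"
    unfolding L_def linear_conv_bounded_linear[symmetric]
    by (rule linearI) (simp_all add: inner_add_right)
  define \<xi> where "\<xi> = (\<lambda>z :: (real^2) \<times> (real^2) \<times> (real^2^2) \<times> (real^2).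
    xi t (fst (snd z)) (fst (snd (snd z))) (snd (snd (snd z))))"
  define G :: "real^2 \<Rightarrow> real^2" where
    "G w = - ((1 / (\<alpha>1 * Tc1) * exp (norm w powr \<alpha>1)) *\<^sub>R (norm w powr - \<alpha>1 *\<^sub>R w))" for w
  define g where "g = (\<lambda>z. L (0, G (\<xi> z), 0, 0))"
  have "matrix_inv A ** A = mat 1"
    using A invertible_det_nz unfolding invertible_def matrix_inv_def
    by (metis (mono_tags, lifting) someI_ex)
  then have \<xi>z: "\<xi> (Y, X, A, r) = X - c"
    using \<open>t > 0\<close> r unfolding \<xi>_def xi_def
    by (simp add: matrix_vector_mul_assoc flip: matrix_vector_mult_diff_distrib)
  have cont_inv: "isCont (\<lambda>z. matrix_inv (fst (snd (snd z)))) (Y, X, A, r)"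
    by (rule isCont_o2[where g = matrix_inv]) (auto intro!: continuous_intros isCont_matrix_inv_2 A)
  have cont_\<xi>: "isCont \<xi> (Y, X, A, r)"
    unfolding \<xi>_def xi_def using \<open>t > 0\<close>
    by (simp, intro isCont_matrix_vector_mult cont_inv continuous_intros)
  have "isCont G w" if "w \<noteq> 0" for w
    unfolding G_def[abs_def] using that by (intro continuous_intros) auto
  then have "isCont (\<lambda>z. G (\<xi> z)) (Y, X, A, r)"
    using \<xi>z \<open>X \<noteq> c\<close> by (intro isCont_o2[OF cont_\<xi>]) auto
  then have "isCont g (Y, X, A, r)"
    unfolding g_def L_def by (intro continuous_intros) auto
  moreover have "g z \<le> L (stationary_loop t z)" for z
    by (cases z) (simp add: g_def L_def G_def \<xi>_def closed_loop_def estimator_rhs_def Let_def psi_def)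
  ultimately have "g (Y, X, A, r) \<le> L (vy, vx, vP, vq)"
    by (intro filippov_map_linear_ge[OF v L]) auto
  then have "(X - c) \<bullet> vx \<le> (X - c) \<bullet> G (X - c)"
    unfolding g_def \<xi>z L_def by simp
  also have "\<dots> = - (exp (norm (X - c) powr \<alpha>1) * (norm (X - c) powr - \<alpha>1 * (norm (X - c))\<^sup>2) / (\<alpha>1 * Tc1))"
    unfolding G_def by (simp add: power2_norm_eq_inner)
  also have "norm (X - c) powr - \<alpha>1 * (norm (X - c))\<^sup>2 = norm (X - c) powr (2 - \<alpha>1)"
    using \<open>X \<noteq> c\<close> by (simp add: powr_diff powr_minus field_simps)
  finally show ?thesis .
qed

end

section \<open>Trajectories and convergence of the estimator\<close>

locale circumnavigation_trajectory =
  fixes dstar \<omega>star \<alpha>1 \<alpha>2 Tc1 Tc2 :: real and c :: "real^2"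
    and y xhat q :: "real \<Rightarrow> real^2" and P :: "real \<Rightarrow> real^2^2"
  assumes pos: "dstar > 0" "\<omega>star > 0" "0 < \<alpha>1" "0 < \<alpha>2" "\<alpha>2 \<le> 1" "0 < Tc1" "0 < Tc2"
    and solution: "filippov_solution (stationary_loop dstar \<omega>star \<alpha>1 \<alpha>2 Tc1 Tc2 c)
                     (\<lambda>t. (y t, xhat t, P t, q t))"
    and P0: "P 0 = 0" and q0: "q 0 = 0" and y0: "y 0 \<noteq> c"
begin

definition velocity where
  "velocity t vy vx vP vq \<longleftrightarrow>
     (y has_vector_derivative vy) (at t) \<and> (xhat has_vector_derivative vx) (at t) \<and>
     (P has_vector_derivative vP) (at t) \<and> (q has_vector_derivative vq) (at t) \<and>
     (vy, vx, vP, vq) \<in> filippov_map (stationary_loop dstar \<omega>star \<alpha>1 \<alpha>2 Tc1 Tc2 c) t (y t, xhat t, P t, q t)"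

lemma AE_velocity: "AE t in lebesgue. 0 < t \<longrightarrow> (\<exists>vy vx vP vq. velocity t vy vx vP vq)"
proof -
  have *: "\<exists>vy vx vP vq. velocity t vy vx vP vq"
    if v: "v \<in> filippov_map (stationary_loop dstar \<omega>star \<alpha>1 \<alpha>2 Tc1 Tc2 c) t (y t, xhat t, P t, q t)"
      and d: "((\<lambda>t. (y t, xhat t, P t, q t)) has_vector_derivative v) (at t)" for t v
  proof -
    obtain vy vx vP vq where v_eq: "v = (vy, vx, vP, vq)" by (cases v)
    note fst = bounded_linear.has_vector_derivative[OF bounded_linear_fst]
    note snd = bounded_linear.has_vector_derivative[OF bounded_linear_snd]
    have "velocity t vy vx vP vq"
      using fst[OF d] fst[OF snd[OF d]] fst[OF snd[OF snd[OF d]]] snd[OF snd[OF snd[OF d]]] v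
      unfolding velocity_def v_eq by simp
    then show ?thesis by blast
  qed
  have "AE t in lebesgue. 0 < t \<longrightarrow>
      (\<exists>v\<in>filippov_map (stationary_loop dstar \<omega>star \<alpha>1 \<alpha>2 Tc1 Tc2 c) t (y t, xhat t, P t, q t).
        ((\<lambda>t. (y t, xhat t, P t, q t)) has_vector_derivative v) (at t))"
    using solution unfolding filippov_solution_def by blast
  then show ?thesis
    by eventually_elim (use * in blast)
qed

lemma abs_continuous:
  assumes "0 < T"
  shows "abs_continuous_on_interval 0 T y" "abs_continuous_on_interval 0 T xhat"
    "abs_continuous_on_interval 0 T P" "abs_continuous_on_interval 0 T q"
proof -
  have z: "abs_continuous_on_interval 0 T (\<lambda>t. (y t, xhat t, P t, q t))"
    using solution assms unfolding filippov_solution_def by blast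
  note fst = abs_continuous_bounded_linear[OF bounded_linear_fst]
  note snd = abs_continuous_bounded_linear[OF bounded_linear_snd]
  show "abs_continuous_on_interval 0 T y" "abs_continuous_on_interval 0 T xhat"
    "abs_continuous_on_interval 0 T P" "abs_continuous_on_interval 0 T q"
    using fst[OF z] fst[OF snd[OF z]] fst[OF snd[OF snd[OF z]]] snd[OF snd[OF snd[OF z]]]
    by simp_all
qed

text \<open>
  The form in which all differential inequalities are integrated below.
\<close>

lemma mono_if_velocity:
  fixes g :: "real \<Rightarrow> real"
  assumes "0 \<le> a" "a \<le> b" "abs_continuous_on_interval a b g"
    and d: "\<And>t vy vx vP vq. a < t \<Longrightarrow> t < b \<Longrightarrow> velocity t vy vx vP vq \<Longrightarrow>
      \<exists>d\<ge>0. (g has_vector_derivative d) (at t)"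
  shows "g a \<le> g b"
proof (rule abs_continuous_mono_if_AE_deriv_nonneg[OF assms(3,2)])
  show "AE t in lebesgue. a < t \<and> t < b \<longrightarrow> (\<exists>d\<ge>0. (g has_vector_derivative d) (at t))"
    using AE_velocity by eventually_elim (use d \<open>0 \<le> a\<close> in force)
qed

lemma bounded_linear_mult_vector: "bounded_linear (\<lambda>A :: real^2^2. A *v e)"
  unfolding linear_conv_bounded_linear[symmetric]
  by (rule linearI)
    (simp_all add: matrix_vector_mult_add_rdistrib flip: scaleR_matrix_vector_assoc)

text \<open>
  The squared norm of the residual \<open>P *v c - q\<close> does not increase, and it starts at zero.
\<close>

lemma q_eq:
  assumes "0 \<le> t"
  shows "q t = P t *v c"
proof (cases "t = 0")
  case False
  define E where "E = (\<lambda>s. P s *v c - q s)"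
  have "- (E 0 \<bullet> E 0) \<le> - (E t \<bullet> E t)"
  proof (rule mono_if_velocity[where g = "\<lambda>s. - (E s \<bullet> E s)" and a = 0 and b = t])
    have Pc: "abs_continuous_on_interval 0 t (\<lambda>s. P s *v c)"
      using abs_continuous_bounded_linear[OF bounded_linear_mult_vector] abs_continuous(3)[of t] assms False
      by auto
    have "abs_continuous_on_interval 0 t E"
      unfolding E_def
    proof (rule abs_continuous_dominated[OF Pc, of q _ 1])
      show "norm (P v *v c - q v - (P u *v c - q u)) \<le> 1 * (norm (P v *v c - P u *v c) + norm (q v - q u))" for u v
        using norm_triangle_ineq4[of "P v *v c - P u *v c" "q v - q u"] by (simp add: algebra_simps)
    qed (use abs_continuous(4) assms False in auto)
    then show "abs_continuous_on_interval 0 t (\<lambda>s. - (E s \<bullet> E s))"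
      using abs_continuous_bounded_linear[OF bounded_linear_minus[OF bounded_linear_ident]]
        abs_continuous_bounded_bilinear[OF bounded_bilinear_inner] by blast
  next
    fix s vy vx vP vq assume v: "velocity s vy vx vP vq"
    then have "(E has_vector_derivative (vP *v c - vq)) (at s)"
      unfolding velocity_def E_def
      by (intro has_vector_derivative_diff bounded_linear.has_vector_derivative[OF bounded_linear_mult_vector]) auto
    note D = this
    have "((\<lambda>s. - (E s \<bullet> E s)) has_vector_derivative - (2 * (E s \<bullet> (vP *v c - vq)))) (at s)"
      using has_vector_derivative_minus[OF bounded_bilinear.has_vector_derivative[OF bounded_bilinear_inner D D]]
      by (simp add: inner_commute)
    moreover have "E s \<bullet> (vP *v c - vq) \<le> - (E s \<bullet> E s)"
      using v velocity_residual unfolding velocity_def E_def by blast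
    then have "0 \<le> - (2 * (E s \<bullet> (vP *v c - vq)))"
      using inner_ge_zero[of "E s"] by linarith
    ultimately show "\<exists>d\<ge>0. ((\<lambda>s. - (E s \<bullet> E s)) has_vector_derivative d) (at s)" by blast
  qed (use assms in auto)
  then have "E t \<bullet> E t \<le> 0" by (simp add: E_def P0 q0)
  then have "E t = 0" by (metis inner_ge_zero inner_eq_zero_iff order_antisym)
  then show ?thesis unfolding E_def by simp
qed (simp add: P0 q0)

lemma initially_separated:
  obtains \<epsilon> where "0 < \<epsilon>" "\<And>t. 0 \<le> t \<Longrightarrow> t < \<epsilon> \<Longrightarrow> y t \<noteq> c"
proof -
  have "continuous_on {0..1} y"
    using abs_continuous(1)[of 1] abs_continuous_imp_continuous_on by force
  moreover have "0 < dist (y 0) c" using y0 by simp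
  ultimately obtain d where "d > 0" and d: "\<And>t. t \<in> {0..1} \<Longrightarrow> dist t 0 < d \<Longrightarrow> dist (y t) (y 0) < dist (y 0) c"
    unfolding continuous_on_iff by (metis atLeastAtMost_iff order_refl zero_le_one)
  show ?thesis
  proof (rule that[of "min d 1"])
    show "y t \<noteq> c" if "0 \<le> t" "t < min d 1" for t
      using d[of t] that by (auto simp: dist_commute)
  qed (use \<open>d > 0\<close> in auto)
qed

text \<open>
  The weight \<open>exp t\<close> is the integrating factor that cancels the forgetting term \<open>- P\<close>, which
  makes this quantity nondecreasing.
\<close>

definition excitation :: "real^2 \<Rightarrow> real \<Rightarrow> real" where
  "excitation e t = exp t * (e \<bullet> (P t *v e))"

lemma excitation_deriv:
  assumes "velocity t vy vx vP vq"
  shows "(excitation e has_vector_derivative exp t * (e \<bullet> (vP *v e) + e \<bullet> (P t *v e))) (at t)"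
proof -
  have "(P has_vector_derivative vP) (at t)" using assms unfolding velocity_def by blast
  then have "((\<lambda>s. e \<bullet> (P s *v e)) has_vector_derivative e \<bullet> (vP *v e)) (at t)"
    by (intro bounded_linear.has_vector_derivative[OF bounded_linear_inner_right]
        bounded_linear.has_vector_derivative[OF bounded_linear_mult_vector])
  moreover have "(exp has_vector_derivative exp t) (at t)"
    using DERIV_exp[of t] by (simp flip: has_real_derivative_iff_has_vector_derivative)
  ultimately show ?thesis
    unfolding excitation_def[abs_def]
    using bounded_bilinear.has_vector_derivative[OF bounded_bilinear_mult]
    by (fastforce simp: algebra_simps)
qed

lemma excitation_mono:
  assumes "0 \<le> a" "a \<le> b"
  shows "excitation e a \<le> excitation e b"
proof (cases "b = 0")
  case False
  with assms have "0 < b" by simp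
  show ?thesis
  proof (rule mono_if_velocity[OF assms])
    have "abs_continuous_on_interval 0 b (\<lambda>t. e \<bullet> (P t *v e))"
      using abs_continuous(3)[OF \<open>0 < b\<close>]
      by (intro abs_continuous_bounded_linear[OF bounded_linear_inner_right]
          abs_continuous_bounded_linear[OF bounded_linear_mult_vector])
    moreover have "abs_continuous_on_interval 0 b (exp :: real \<Rightarrow> real)"
      by (rule abs_continuous_compose_C1[OF abs_continuous_ident, where g' = exp and m = 0 and M = b])
        (auto intro: continuous_intros)
    ultimately have "abs_continuous_on_interval 0 b (excitation e)"
      unfolding excitation_def[abs_def]
      by (intro abs_continuous_bounded_bilinear[OF bounded_bilinear_mult])
    then show "abs_continuous_on_interval a b (excitation e)"
      using abs_continuous_subset \<open>0 \<le> a\<close> by blast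
  next
    fix t vy vx vP vq assume v: "velocity t vy vx vP vq"
    then have "- (e \<bullet> (P t *v e)) \<le> e \<bullet> (vP *v e)"
      using velocity_quadratic_form unfolding velocity_def by blast
    then show "\<exists>d\<ge>0. (excitation e has_vector_derivative d) (at t)"
      using excitation_deriv[OF v, of e] by (intro exI conjI) auto
  qed
qed (use assms in simp)

lemma bearing_perp_orthogonal_imp_parallel:
  assumes "Y \<noteq> c" "bearing_perp c Y \<bullet> e = 0" "e \<noteq> 0"
  obtains k where "c - Y = k *\<^sub>R e"
proof -
  define d where "d = c - Y"
  have "d \<noteq> 0" using assms unfolding d_def by simp
  then have "rotate_clockwise d \<bullet> e = 0"
    using assms(2) unfolding bearing_perp_eq d_def[symmetric] by simp
  then have d: "d $ 2 * e $ 1 = d $ 1 * e $ 2" by (simp add: inner_vec_def sum_2)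
  have "(e \<bullet> e) * d $ 1 = (d \<bullet> e) * e $ 1" "(e \<bullet> e) * d $ 2 = (d \<bullet> e) * e $ 2"
    unfolding inner_vec_def sum_2 inner_real_def using d by algebra+
  then have "(e \<bullet> e) *\<^sub>R d = (d \<bullet> e) *\<^sub>R e" by (simp add: vec_eq_iff forall_2)
  then have "d = ((d \<bullet> e) / (e \<bullet> e)) *\<^sub>R e"
    using \<open>e \<noteq> 0\<close> by (metis (no_types, lifting) divide_inverse_commute inner_eq_zero_iff
        left_inverse scaleR_one scaleR_scaleR)
  then show ?thesis using that unfolding d_def by blast
qed

text \<open>
  If the quadratic form vanished in direction \<open>e\<close>, the agent would move along the line through the
  target in direction \<open>e\<close> on an initial interval, against its positive tangential velocity.
\<close>

lemma P_pos_def: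
  assumes "0 < t" "e \<noteq> 0"
  shows "0 < e \<bullet> (P t *v e)"
proof (rule ccontr)
  assume "\<not> 0 < e \<bullet> (P t *v e)"
  then have "excitation e t \<le> 0" by (simp add: excitation_def mult_nonneg_nonpos)
  moreover have "excitation e 0 = 0" by (simp add: excitation_def P0)
  ultimately have zero: "excitation e s = 0" if "0 \<le> s" "s \<le> t" for s
    using excitation_mono[of 0 s e] excitation_mono[of s t e] that by linarith
  obtain \<epsilon>' where \<epsilon>': "0 < \<epsilon>'" "\<And>s. 0 \<le> s \<Longrightarrow> s < \<epsilon>' \<Longrightarrow> y s \<noteq> c"
    using initially_separated by blast
  define \<epsilon> where "\<epsilon> = min \<epsilon>' t"
  have \<epsilon>: "0 < \<epsilon>" "\<epsilon> \<le> t" "\<And>s. 0 \<le> s \<Longrightarrow> s < \<epsilon> \<Longrightarrow> y s \<noteq> c"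
    using \<epsilon>' assms unfolding \<epsilon>_def by auto
  \<comment> \<open>the offset of the agent from the line through the target in direction \<open>e\<close>, up to scaling\<close>
  define h where "h = (\<lambda>s. (y s - c) \<bullet> rotate_clockwise e)"
  have orth: "bearing_perp c (y s) \<bullet> e = 0" if s: "0 < s" "s < \<epsilon>" and v: "velocity s vy vx vP vq" for s vy vx vP vq
  proof -
    have "(excitation e has_vector_derivative 0) (at s)"
    proof (rule has_vector_derivative_transform_within_open[where f = "\<lambda>_. 0" and S = "{0<..<\<epsilon>}"])
    qed (use s zero \<epsilon> in auto)
    then have "exp s * (e \<bullet> (vP *v e) + e \<bullet> (P s *v e)) = 0"
      using excitation_deriv[OF v] vector_derivative_unique_at by blast
    then have "e \<bullet> (vP *v e) + e \<bullet> (P s *v e) = 0" by simp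
    moreover have "(bearing_perp c (y s) \<bullet> e)\<^sup>2 - e \<bullet> (P s *v e) \<le> e \<bullet> (vP *v e)"
      using v velocity_quadratic_form_regular \<epsilon>(3)[of s] s unfolding velocity_def by auto
    ultimately show ?thesis
      using zero[of s] s \<epsilon> by (simp add: excitation_def)
  qed
  have h0: "h s = 0" if s: "0 < s" "s < \<epsilon>" and v: "velocity s vy vx vP vq" for s vy vx vP vq
  proof -
    have "y s \<noteq> c" using \<epsilon>(3)[of s] s by simp
    then obtain k where k: "c - y s = k *\<^sub>R e"
      using bearing_perp_orthogonal_imp_parallel orth[OF s v] assms by blast
    have "h s = - ((c - y s) \<bullet> rotate_clockwise e)" by (simp add: h_def inner_diff_left)
    then show ?thesis unfolding k by simp
  qed
  obtain M where M: "M \<in> null_sets lebesgue"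
    "{s. \<not> (0 < s \<longrightarrow> (\<exists>vy vx vP vq. velocity s vy vx vP vq))} \<subseteq> M"
    using AE_velocity unfolding eventually_ae_filter by auto
  \<comment> \<open>the offset vanishes at almost all times, hence at all times by continuity\<close>
  have "continuous_on {0<..<\<epsilon>} h"
    unfolding h_def using abs_continuous_imp_continuous_on[OF abs_continuous(1)[OF \<epsilon>(1)]]
    by (intro continuous_intros) (auto elim: continuous_on_subset)
  then have "open ({0<..<\<epsilon>} \<inter> h -` (- {0}))"
    by (intro continuous_open_preimage) auto
  moreover have "negligible ({0<..<\<epsilon>} \<inter> h -` (- {0}))"
  proof (rule negligible_subset)
    show "negligible M" using M(1) negligible_iff_null_sets by blast
    show "{0<..<\<epsilon>} \<inter> h -` (- {0}) \<subseteq> M" using M(2) h0 by auto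
  qed
  ultimately have "{0<..<\<epsilon>} \<inter> h -` (- {0}) = {}"
    using open_not_negligible by blast
  then have h_zero: "h s = 0" if "0 < s" "s < \<epsilon>" for s using that by auto
  have "\<exists>s vy vx vP vq. 0 < s \<and> s < \<epsilon> \<and> velocity s vy vx vP vq"
  proof (rule ccontr)
    assume "\<not> ?thesis"
    then have "{0<..<\<epsilon>} \<subseteq> M" using M(2) by auto
    then have "negligible {0<..<\<epsilon>}" using M(1) negligible_iff_null_sets negligible_subset by blast
    then show False using open_not_negligible[of "{0<..<\<epsilon>}"] \<epsilon>(1) by auto
  qed
  then obtain s vy vx vP vq where s: "0 < s" "s < \<epsilon>" and v: "velocity s vy vx vP vq" by blast
  have "(h has_vector_derivative 0) (at s)"
  proof (rule has_vector_derivative_transform_within_open[where f = "\<lambda>_. 0" and S = "{0<..<\<epsilon>}"])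
  qed (use s h_zero in auto)
  moreover have "(h has_vector_derivative vy \<bullet> rotate_clockwise e) (at s)"
  proof -
    have "((\<lambda>s. y s - c) has_vector_derivative vy - 0) (at s)"
      using v unfolding velocity_def by (intro has_vector_derivative_diff has_vector_derivative_const) auto
    from bounded_linear.has_vector_derivative[OF bounded_linear_inner_left this] show ?thesis
      unfolding h_def by simp
  qed
  ultimately have "vy \<bullet> rotate_clockwise e = 0" using vector_derivative_unique_at by blast
  moreover have "y s \<noteq> c" using \<epsilon>(3)[of s] s by simp
  moreover from this obtain k where "c - y s = k *\<^sub>R e"
    using bearing_perp_orthogonal_imp_parallel orth[OF s v] assms by blast
  moreover have "0 < vy \<bullet> rotate_clockwise (c - y s)"
    using velocity_tangential v \<epsilon>(3)[of s] s pos unfolding velocity_def by fastforce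
  ultimately show False by (simp add: rotate_clockwise_scaleR)
qed

lemma det_P:
  assumes "0 < t"
  shows "det (P t) \<noteq> 0"
proof -
  have "\<forall>e. P t *v e = 0 \<longrightarrow> e = 0"
    using P_pos_def[OF assms] by (metis inner_zero_right less_irrefl)
  then have "invertible (P t)"
    by (simp add: invertible_left_inverse matrix_left_invertible_ker)
  then show ?thesis by (simp add: invertible_det_nz)
qed

definition sq_error :: "real \<Rightarrow> real" where
  "sq_error t = (xhat t - c) \<bullet> (xhat t - c)"

lemma sq_error_eq: "sq_error t = (norm (xhat t - c))\<^sup>2"
  by (simp add: sq_error_def power2_norm_eq_inner)

lemma sq_error_deriv:
  assumes v: "velocity t vy vx vP vq"
  shows "(sq_error has_vector_derivative 2 * ((xhat t - c) \<bullet> vx)) (at t)"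
proof -
  have D: "((\<lambda>s. xhat s - c) has_vector_derivative vx - 0) (at t)"
    using v unfolding velocity_def by (intro has_vector_derivative_diff has_vector_derivative_const) auto
  show ?thesis
    using bounded_bilinear.has_vector_derivative[OF bounded_bilinear_inner D D]
    unfolding sq_error_def[abs_def] by (simp add: inner_commute)
qed

lemma error_velocity:
  assumes v: "velocity t vy vx vP vq" and "0 < t" and "xhat t \<noteq> c"
  shows "(xhat t - c) \<bullet> vx \<le>
    - (exp (norm (xhat t - c) powr \<alpha>1) * norm (xhat t - c) powr (2 - \<alpha>1) / (\<alpha>1 * Tc1))"
proof (rule velocity_estimator)
  show "(vy, vx, vP, vq) \<in> filippov_map (stationary_loop dstar \<omega>star \<alpha>1 \<alpha>2 Tc1 Tc2 c) t (y t, xhat t, P t, q t)"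
    using v unfolding velocity_def by blast
qed (use assms pos det_P q_eq in auto)

lemma abs_continuous_sq_error:
  assumes "0 < T"
  shows "abs_continuous_on_interval 0 T sq_error"
proof -
  note x = abs_continuous(2)[OF assms]
  have "abs_continuous_on_interval 0 T (\<lambda>s. xhat s - c)"
    by (rule abs_continuous_dominated[OF x x, of _ 1]) simp
  then show ?thesis
    unfolding sq_error_def[abs_def] by (intro abs_continuous_bounded_bilinear[OF bounded_bilinear_inner])
qed

text \<open>
  Where the error is zero, the derivative of its square vanishes whatever the velocity, so the
  possible discontinuity of the estimator there is harmless.
\<close>

lemma sq_error_antimono:
  assumes "0 \<le> a" "a \<le> b"
  shows "sq_error b \<le> sq_error a"
proof (cases "b = 0")
  case False
  have "- sq_error a \<le> - sq_error b"
  proof (rule mono_if_velocity[where g = "\<lambda>s. - sq_error s", OF assms])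
    have "abs_continuous_on_interval a b sq_error"
      by (rule abs_continuous_subset[OF abs_continuous_sq_error[of b]]) (use False assms in auto)
    then show "abs_continuous_on_interval a b (\<lambda>s. - sq_error s)"
      by (rule abs_continuous_bounded_linear[OF bounded_linear_minus[OF bounded_linear_ident]])
  next
    fix t vy vx vP vq assume t: "a < t" and v: "velocity t vy vx vP vq"
    have "(xhat t - c) \<bullet> vx \<le> 0"
    proof (cases "xhat t = c")
      case False
      have "0 \<le> exp (norm (xhat t - c) powr \<alpha>1) * norm (xhat t - c) powr (2 - \<alpha>1) / (\<alpha>1 * Tc1)"
        using pos by simp
      then show ?thesis using error_velocity[OF v _ False] t assms by linarith
    qed simp
    then show "\<exists>d\<ge>0. ((\<lambda>s. - sq_error s) has_vector_derivative d) (at t)"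
      using has_vector_derivative_minus[OF sq_error_deriv[OF v]]
      by (intro exI[of _ "- (2 * ((xhat t - c) \<bullet> vx))"]) auto
  qed
  then show ?thesis by simp
qed (use assms in simp)

text \<open>
  As the error is nonincreasing, a nonzero error at time \<open>T\<close> was nonzero before and bounded below.
  Then \<open>exp (- (V powr \<alpha>1))\<close> would have gained at least \<open>T / Tc1 \<ge> 1\<close> from a positive initial
  value, but it never exceeds one.
\<close>

lemma predefined_time_convergence:
  assumes T: "Tc1 \<le> T"
  shows "xhat T = c"
proof (rule ccontr)
  assume "xhat T \<noteq> c"
  have "0 < T" using T pos by simp
  define m where "m = sq_error T"
  have "0 < m" using \<open>xhat T \<noteq> c\<close> unfolding m_def sq_error_eq by simp
  have range: "sq_error s \<in> {m..sq_error 0}" if "s \<in> {0..T}" for s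
    using sq_error_antimono[of 0 s] sq_error_antimono[of s T] that unfolding m_def by simp
  \<comment> \<open>in terms of the squared error, which is differentiable, the exponent is halved\<close>
  define g where "g = (\<lambda>s. exp (- (s powr (\<alpha>1 / 2))))"
  define g' where "g' = (\<lambda>s. exp (- (s powr (\<alpha>1 / 2))) * - (\<alpha>1 / 2 * s powr (\<alpha>1 / 2 - 1)))"
  have g: "(g has_real_derivative g' s) (at s)" if "0 < s" for s
    unfolding g_def g'_def using that by (auto intro!: derivative_eq_intros)
  define G where "G = (\<lambda>s. g (sq_error s) - s / Tc1)"
  have "G 0 \<le> G T"
  proof (rule mono_if_velocity[where g = G and a = 0 and b = T])
    have "abs_continuous_on_interval 0 T (\<lambda>s. g (sq_error s))"
    proof (rule abs_continuous_compose_C1[OF abs_continuous_sq_error[OF \<open>0 < T\<close>] range])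
      show "(g has_real_derivative g' s) (at s)" if "s \<in> {m..sq_error 0}" for s
        using g that \<open>0 < m\<close> by simp
      show "continuous_on {m..sq_error 0} g'"
        unfolding g'_def using \<open>0 < m\<close> by (intro continuous_intros) auto
    qed
    then show "abs_continuous_on_interval 0 T G"
    proof (rule abs_continuous_dominated[OF _ abs_continuous_ident, of _ _ _ _ "max 1 (1 / Tc1)"])
      fix u v :: real
      have "norm (G v - G u) \<le> norm (g (sq_error v) - g (sq_error u)) + norm (v / Tc1 - u / Tc1)"
        unfolding G_def real_norm_def by linarith
      also have "norm (v / Tc1 - u / Tc1) = 1 / Tc1 * norm (v - u)"
      proof -
        have "v / Tc1 - u / Tc1 = 1 / Tc1 * (v - u)" by (simp add: diff_divide_distrib)
        then show ?thesis using pos by (simp only: norm_mult) simp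
      qed
      also have "norm (g (sq_error v) - g (sq_error u)) + 1 / Tc1 * norm (v - u) \<le>
          max 1 (1 / Tc1) * norm (g (sq_error v) - g (sq_error u)) + max 1 (1 / Tc1) * norm (v - u)"
        by (intro add_mono mult_right_mono) (auto simp: mult_le_cancel_right1)
      finally show "norm (G v - G u) \<le>
          max 1 (1 / Tc1) * (norm (g (sq_error v) - g (sq_error u)) + norm (v - u))"
        by (simp add: distrib_left)
    qed
  next
    fix t vy vx vP vq assume t: "0 < t" "t < T" and v: "velocity t vy vx vP vq"
    define n where "n = norm (xhat t - c)"
    have N: "sq_error t = n\<^sup>2" "0 < sq_error t"
      using range[of t] t \<open>0 < m\<close> unfolding n_def sq_error_eq by auto
    then have "0 < n" "xhat t \<noteq> c" unfolding n_def by (auto simp: sq_error_eq)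
    have n_powr: "(n\<^sup>2) powr a = n powr (2 * a)" for a
      using \<open>0 < n\<close> powr_powr[of n 2 a] by simp
    define W where "W = exp (n powr \<alpha>1)"
    have "W > 0" unfolding W_def by simp
    have g'_eq: "g' (sq_error t) = - (\<alpha>1 / 2 * n powr (\<alpha>1 - 2) / W)"
    proof -
      have half: "2 * (\<alpha>1 / 2) = \<alpha>1" "2 * (\<alpha>1 / 2 - 1) = \<alpha>1 - 2" by auto
      have "g' (sq_error t) = exp (- (n powr \<alpha>1)) * - (\<alpha>1 / 2 * n powr (\<alpha>1 - 2))"
        unfolding g'_def N(1) n_powr half ..
      moreover have "exp (- (n powr \<alpha>1)) = 1 / W"
        unfolding W_def by (simp add: exp_minus inverse_eq_divide)
      ultimately show ?thesis by simp
    qed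
    have "(xhat t - c) \<bullet> vx \<le> - (W * n powr (2 - \<alpha>1) / (\<alpha>1 * Tc1))"
      using error_velocity[OF v t(1) \<open>xhat t \<noteq> c\<close>] unfolding W_def n_def .
    then have "(\<alpha>1 * n powr (\<alpha>1 - 2) / W) * (W * n powr (2 - \<alpha>1) / (\<alpha>1 * Tc1))
        \<le> (\<alpha>1 * n powr (\<alpha>1 - 2) / W) * - ((xhat t - c) \<bullet> vx)"
      using pos \<open>W > 0\<close> by (intro mult_left_mono) auto
    moreover have "(\<alpha>1 * n powr (\<alpha>1 - 2) / W) * (W * n powr (2 - \<alpha>1) / (\<alpha>1 * Tc1)) = 1 / Tc1"
    proof -
      have "n powr (\<alpha>1 - 2) * n powr (2 - \<alpha>1) = 1"
        using \<open>0 < n\<close> by (simp flip: powr_add)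
      then show ?thesis using pos \<open>W > 0\<close> by (simp add: field_simps)
    qed
    ultimately have "0 \<le> (2 * ((xhat t - c) \<bullet> vx)) * g' (sq_error t) - 1 / Tc1"
      unfolding g'_eq by (simp add: field_simps)
    moreover have "(G has_vector_derivative (2 * ((xhat t - c) \<bullet> vx)) * g' (sq_error t) - 1 / Tc1) (at t)"
    proof -
      have "(sq_error has_real_derivative 2 * ((xhat t - c) \<bullet> vx)) (at t)"
        using sq_error_deriv[OF v] by (simp add: has_real_derivative_iff_has_vector_derivative)
      from DERIV_chain2[OF g[OF N(2)] this]
      have "((\<lambda>s. g (sq_error s)) has_real_derivative g' (sq_error t) * (2 * ((xhat t - c) \<bullet> vx))) (at t)" .
      then have "(G has_real_derivative g' (sq_error t) * (2 * ((xhat t - c) \<bullet> vx)) - 1 / Tc1) (at t)"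
        unfolding G_def by (intro DERIV_diff DERIV_cdivide DERIV_ident)
      then show ?thesis by (simp add: has_real_derivative_iff_has_vector_derivative mult.commute)
    qed
    ultimately show "\<exists>d\<ge>0. (G has_vector_derivative d) (at t)" by blast
  qed (use \<open>0 < T\<close> in auto)
  moreover have "G 0 > 0" unfolding G_def g_def by simp
  moreover have "1 \<le> T / Tc1" using T pos by simp
  moreover have "g (sq_error T) \<le> 1" unfolding g_def by simp
  ultimately show False unfolding G_def by linarith
qed

end

theorem mainTheorem1:
  fixes dstar \<omega>star \<alpha>1 \<alpha>2 Tc1 Tc2 :: real
    and x y xhat q :: "real \<Rightarrow> real^2"
    and P :: "real \<Rightarrow> real^2^2"
  assumes "dstar > 0" and "\<omega>star > 0"
    and "0 < \<alpha>1" and "\<alpha>1 \<le> 1" and "0 < \<alpha>2" and "\<alpha>2 \<le> 1"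
    and "0 < Tc1" and "Tc1 < Tc2"
    and closed_loop: "filippov_solution (closed_loop dstar \<omega>star \<alpha>1 \<alpha>2 Tc1 Tc2 x)
                        (\<lambda>t. (y t, xhat t, P t, q t))"
    and init: "P 0 = 0" "q 0 = 0"
    and A1: "norm (x 0 - y 0) > 0"
    and A2: "\<And>t. t \<ge> 0 \<Longrightarrow> (x has_vector_derivative 0) (at t within {0..})"
    and A3: "\<exists>\<eta>>0. dstar - norm (xhat 0 - x 0) \<ge> \<eta>"
  shows "\<forall>t\<ge>Tc1. norm (xhat t - x t) = 0"
proof -
  obtain k where "\<And>t. t \<in> {0..} \<Longrightarrow> x t = k"
    using has_vector_derivative_zero_constant[of "{0..}" x] A2 by (metis atLeast_iff convex_real_interval(1))
  then have x: "x t = x 0" if "0 \<le> t" for t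
    using that by simp
  have map_eq: "filippov_map (closed_loop dstar \<omega>star \<alpha>1 \<alpha>2 Tc1 Tc2 x) t z =
      filippov_map (stationary_loop dstar \<omega>star \<alpha>1 \<alpha>2 Tc1 Tc2 (x 0)) t z" if "0 < t" for t z
    using x[of t] that by (intro filippov_map_cong) (simp add: closed_loop_def)
  have "AE t in lebesgue. 0 < t \<longrightarrow>
      (\<exists>v\<in>filippov_map (closed_loop dstar \<omega>star \<alpha>1 \<alpha>2 Tc1 Tc2 x) t (y t, xhat t, P t, q t).
        ((\<lambda>t. (y t, xhat t, P t, q t)) has_vector_derivative v) (at t))"
    using closed_loop unfolding filippov_solution_def by blast
  then have "AE t in lebesgue. 0 < t \<longrightarrow>
      (\<exists>v\<in>filippov_map (stationary_loop dstar \<omega>star \<alpha>1 \<alpha>2 Tc1 Tc2 (x 0)) t (y t, xhat t, P t, q t).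
        ((\<lambda>t. (y t, xhat t, P t, q t)) has_vector_derivative v) (at t))"
    by (rule eventually_mono) (simp only: map_eq simp_thms cong: imp_cong)
  then have "filippov_solution (stationary_loop dstar \<omega>star \<alpha>1 \<alpha>2 Tc1 Tc2 (x 0)) (\<lambda>t. (y t, xhat t, P t, q t))"
    using closed_loop unfolding filippov_solution_def by blast
  moreover have "y 0 \<noteq> x 0" using A1 by auto
  moreover have "0 < Tc2" using \<open>0 < Tc1\<close> \<open>Tc1 < Tc2\<close> by (rule less_trans)
  ultimately have "circumnavigation_trajectory dstar \<omega>star \<alpha>1 \<alpha>2 Tc1 Tc2 (x 0) y xhat q P"
    using assms(1-3,5-7) init unfolding circumnavigation_trajectory_def by blast
  then interpret circumnavigation_trajectory dstar \<omega>star \<alpha>1 \<alpha>2 Tc1 Tc2 "x 0" y xhat q P .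
  show ?thesis
  proof (intro allI impI)
    fix t assume t: "Tc1 \<le> t"
    then have "x t = x 0" using \<open>0 < Tc1\<close> by (intro x) simp
    then show "norm (xhat t - x t) = 0" using predefined_time_convergence[OF t] by simp
  qed
qed

end
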